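(* Let $q$ be a prime power, and let $d\ge1$, $m>1$ and $n\ge2$ be integers. For any factorization $\Lambda_1\Lambda_2\cdots\Lambda_{n-1}=\theta(m-1,q^{d+1})$ into positive integers, there exists a J-optimal (ideal) $(\Lambda_1\times\Lambda_2\times\cdots\times\Lambda_{n-1}\times\theta(d,q),\,q+1,\,0,\,1)$ $n$-D OOC.
   Context: Here $\theta(k,Q)=\frac{Q^{k+1}-1}{Q-1}$. An $n$-dimensional optical orthogonal code ($n$-D OOC) with parameters $(\Lambda_1\times\cdots\times\Lambda_{n-1}\times T,w,\lambda_a,\lambda_c)$ is a nonempty set $C$ of binary ($0/1$) arrays $A=(a_{i_1,\dots,i_n})$, indexed by $0\le i_s\le\Lambda_s-1$ for $1\le s\le n-1$ and $0\le i_n\le T-1$, called codewords, each having exactly $w$ entries equal to $1$, such that (the last subscript being read modulo $T$): (i) for every $A\in C$ and every integer $1\le t\le T-1$, $\sum_{i_1,\dots,i_n}a_{i_1,\dots,i_n}a_{i_1,\dots,i_n+t}\le\lambda_a$; (ii) for all distinct $A,B\in C$ and every integer $0\le t\le T-1$, $\sum_{i_1,\dots,i_n}a_{i_1,\dots,i_n}b_{i_1,\dots,i_n+t}\le\lambda_c$. The sums run over all index tuples. The code is ideal if $\lambda_a=0$. A code is J-optimal if its size meets the applicable Johnson-type upper bound. For an ideal $(\Lambda_1\times\cdots\times\Lambda_{n-1}\times T,w,0,\lambda_c)$ code with $N=\Lambda_1\cdots\Lambda_{n-1}T$ the bound is $$|C|\le\left\lfloor\frac{N}{Tw}\left\lfloor\frac{N-T}{w-1}\left\lfloor\cdots\left\lfloor\frac{N-\lambda_cT}{w-\lambda_c}\right\rfloor\cdots\right\rfloor\right\rfloor\right\rfloor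 ,$$ which for $\lambda_c=1$ reads $|C|\le\left\lfloor\frac{N}{Tw}\left\lfloor\frac{N-T}{w-1}\right\rfloor\right\rfloor$; J-optimal means that equality holds. *)

theory Defs
  imports Complex_Main "HOL-Library.FuncSet" "HOL-Number_Theory.Prime_Powers"
begin

text \<open>The division is exact for \<open>Q \<ge> 2\<close>, see \<open>theta_mult\<close> below.\<close>
definition theta :: "nat \<Rightarrow> nat \<Rightarrow> nat" where
  "theta k Q = (Q ^ (k + 1) - 1) div (Q - 1)"

lemma theta_mult: "theta k Q * (Q - 1) = Q ^ (k + 1) - 1"
proof (cases "Q = 0")
  case False
  then have "(int Q - 1) dvd (int Q ^ (k + 1) - 1)"
    using power_diff_1_eq[of "int Q" "k + 1"] by simp
  with False have "(Q - 1) dvd (Q ^ (k + 1) - 1)"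
    by (simp add: of_nat_diff flip: int_dvd_int_iff)
  then show ?thesis
    unfolding theta_def by (rule dvd_div_mult_self)
qed (simp add: theta_def)

text \<open>Throughout, an \<open>n\<close>-dimensional format \<open>\<Lambda>\<^sub>1 \<times> \<dots> \<times> \<Lambda>\<^sub>n\<^sub>-\<^sub>1 \<times> T\<close> is given by the list
  \<open>Ls = [\<Lambda>\<^sub>1, \<dots>, \<Lambda>\<^sub>n\<^sub>-\<^sub>1]\<close> and the number \<open>T\<close>. A subscript \<open>(i\<^sub>1, \<dots>, i\<^sub>n)\<close> is a list of length
  \<open>n\<close>, so list position \<open>s - 1\<close> holds \<open>i\<^sub>s\<close>.\<close>

definition indices :: "nat list \<Rightarrow> nat \<Rightarrow> nat list set" where
  "indices Ls T = {x. list_all2 (<) x (Ls @ [T])}"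

definition shift_last :: "nat \<Rightarrow> nat \<Rightarrow> nat list \<Rightarrow> nat list" where
  "shift_last T t x = butlast x @ [(last x + t) mod T]"

text \<open>Arrays are extensional functions on the index set, so distinct elements of the set differ
  at an actual entry and cardinalities count arrays.\<close>
definition binary_arrays :: "nat list \<Rightarrow> nat \<Rightarrow> (nat list \<Rightarrow> nat) set" where
  "binary_arrays Ls T = indices Ls T \<rightarrow>\<^sub>E {0, 1}"

definition correlation ::
  "nat list \<Rightarrow> nat \<Rightarrow> nat \<Rightarrow> (nat list \<Rightarrow> nat) \<Rightarrow> (nat list \<Rightarrow> nat) \<Rightarrow> nat" where
  "correlation Ls T t A B = (\<Sum>x\<in>indices Ls T. A x * B (shift_last T t x))"

definition OOC ::
  "nat list \<Rightarrow> nat \<Rightarrow> nat \<Rightarrow> nat \<Rightarrow> nat \<Rightarrow> (nat list \<Rightarrow> nat) set \<Rightarrow> bool" where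
  "OOC Ls T w la lc C \<longleftrightarrow>
     C \<noteq> {} \<and> C \<subseteq> binary_arrays Ls T \<and>
     (\<forall>A\<in>C. card {x \<in> indices Ls T. A x = 1} = w) \<and>
     (\<forall>A\<in>C. \<forall>t\<in>{1..<T}. correlation Ls T t A A \<le> la) \<and>
     (\<forall>A\<in>C. \<forall>B\<in>C. A \<noteq> B \<longrightarrow> (\<forall>t\<in>{0..<T}. correlation Ls T t A B \<le> lc))"

text \<open>The Johnson-type bound for ideal codes. The \<open>foldr\<close> nests the floors for
  \<open>i = 1, \<dots>, lc\<close> from the outside in; its start value 1 makes the innermost floor
  that of \<open>(N - lc T) / (w - lc)\<close>.\<close>
definition johnson_bound_ideal :: "nat list \<Rightarrow> nat \<Rightarrow> nat \<Rightarrow> nat \<Rightarrow> int" where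
  "johnson_bound_ideal Ls T w lc =
     (let N = real (prod_list Ls * T) in
      \<lfloor>N / (real T * real w) *
        of_int (foldr (\<lambda>i z. \<lfloor>(N - real i * real T) / (real w - real i) * of_int z\<rfloor>)
                 [1..<lc + 1] 1)\<rfloor>)"

lemma johnson_bound_ideal_1:
  "johnson_bound_ideal Ls T w 1 =
     (let N = real (prod_list Ls * T) in
      \<lfloor>N / (real T * real w) * of_int \<lfloor>(N - real T) / (real w - 1)\<rfloor>\<rfloor>)"
  by (simp add: johnson_bound_ideal_def Let_def)

definition J_optimal_ideal_OOC ::
  "nat list \<Rightarrow> nat \<Rightarrow> nat \<Rightarrow> nat \<Rightarrow> (nat list \<Rightarrow> nat) set \<Rightarrow> bool" where
  "J_optimal_ideal_OOC Ls T w lc C \<longleftrightarrow>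
     OOC Ls T w 0 lc C \<and> int (card C) = johnson_bound_ideal Ls T w lc"

end

theory Submission
  imports "HOL-Algebra.Algebraic_Closure" "HOL-Number_Theory.Residues" Defs
begin

text \<open>
  The code comes from the lines of a projective space over \<open>GF(q)\<close>. Put \<open>Q = q\<^sup>d\<^sup>+\<^sup>1\<close> and let \<open>E\<close> be the
  field with \<open>Q\<^sup>m\<close> elements, with its subfields \<open>F\<close> of order \<open>q\<close> and \<open>K\<close> of order \<open>Q\<close>. The points of
  the projective space are the classes of nonzero elements of \<open>E\<close> modulo multiplication by nonzero
  elements of \<open>F\<close>, and its lines are the two-dimensional \<open>F\<close>-subspaces. With \<open>M = theta (m - 1) Q\<close>
  and \<open>T = theta d q\<close> there are \<open>M T\<close> points. If \<open>g\<close> generates the cyclic group of nonzero elements of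
  \<open>E\<close>, then \<open>g\<^sup>n\<close> lies in \<open>K\<close> exactly when \<open>M\<close> divides \<open>n\<close>, and in \<open>F\<close> exactly when \<open>M T\<close> divides \<open>n\<close>.
  So every point is represented by exactly one \<open>g\<^sup>c\<^sup>+\<^sup>M\<^sup>i\<close> with \<open>c < M\<close> and \<open>i < T\<close>, and is coded by the pair
  \<open>(c, i)\<close>. In this coordinate system multiplication by \<open>g\<^sup>M\<close> is the cyclic shift of \<open>i\<close>, and two points
  have the same \<open>c\<close> if and only if they span the same one-dimensional \<open>K\<close>-subspace; these subspaces
  form the spread of the geometry.

  Codewords are the lines that are not contained in a spread element, one from each shift orbit. Such
  a line meets every spread element at most once (\<open>inj_on_fst_block\<close>), and a shift moves a point only
  within its spread element, so the autocorrelation is \<open>0\<close>. Two points in different spread elements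
  lie on exactly one line (\<open>unique_block\<close>), so two lines from different orbits have correlation at
  most \<open>1\<close>. Both estimates, as well as the size of the code, depend only on the incidence structure
  \<open>cyclic_block_design\<close>. Counting pairs of points in different spread elements shows that a point lies
  on \<open>r = (M - 1) T / q\<close> of these lines, hence that there are \<open>M T r / (q + 1)\<close> lines. Every
  orbit has \<open>T\<close> elements, so the code has size \<open>M r / (q + 1)\<close>. Both quotients are integers, hence
  the floors in the Johnson bound have no effect and the bound is attained (\<open>J_optimal_code\<close>).

  The factorization of \<open>M\<close> enters only through a bijection between the first \<open>n - 1\<close> subscripts and
  \<open>{..<M}\<close>, because the correlations shift the last subscript alone. The field \<open>E\<close> is obtained as
  the set of roots of \<open>X\<^sup>N - X\<close>, \<open>N = Q\<^sup>m\<close>, in the algebraic closure of the prime field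
  (\<open>finite_field_exists\<close>).
\<close>

section \<open>Optimal codes from cyclic block designs\<close>

definition shift_point :: "nat \<Rightarrow> nat \<Rightarrow> nat \<times> nat \<Rightarrow> nat \<times> nat" where
  "shift_point T t z = (fst z, (snd z + t) mod T)"

text \<open>
  A transversal design on \<open>M\<close> groups \<open>{c} \<times> {..<T}\<close> in which the blocks need not meet every group,
  that is, a group divisible design with \<open>\<lambda> = 1\<close>, which is invariant under the cyclic shift of all
  groups.
\<close>
locale cyclic_block_design =
  fixes M T w :: nat and Blocks :: "(nat \<times> nat) set set"
  assumes M_ge2: "M \<ge> 2" and T_pos: "T > 0" and w_ge2: "w \<ge> 2"
    and block_subset: "\<And>B. B \<in> Blocks \<Longrightarrow> B \<subseteq> {..<M} \<times> {..<T}"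
    and card_block: "\<And>B. B \<in> Blocks \<Longrightarrow> card B = w"
    and inj_on_fst: "\<And>B. B \<in> Blocks \<Longrightarrow> inj_on fst B"
    and unique_block: "\<And>z z'. z \<in> {..<M} \<times> {..<T} \<Longrightarrow> z' \<in> {..<M} \<times> {..<T} \<Longrightarrow> fst z \<noteq> fst z' \<Longrightarrow>
      \<exists>!B. B \<in> Blocks \<and> z \<in> B \<and> z' \<in> B"
    and shift_closed: "\<And>B t. B \<in> Blocks \<Longrightarrow> shift_point T t ` B \<in> Blocks"
begin

abbreviation points :: "(nat \<times> nat) set" where
  "points \<equiv> {..<M} \<times> {..<T}"

lemma finite_block: "B \<in> Blocks \<Longrightarrow> finite B"
  using card_block w_ge2 by (metis card.infinite not_numeral_le_zero)

lemma finite_Blocks: "finite Blocks"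
  using block_subset by (intro finite_subset[of Blocks "Pow points"]) auto

lemma block_eqI:
  assumes "A \<in> Blocks" "B \<in> Blocks" "z \<in> A" "z \<in> B" "z' \<in> A" "z' \<in> B" "z \<noteq> z'"
  shows "A = B"
proof -
  have "fst z \<noteq> fst z'" using inj_on_fst[OF assms(1)] assms by (auto dest: inj_onD)
  moreover have "z \<in> points" "z' \<in> points" using block_subset assms by blast+
  ultimately show ?thesis using unique_block assms by blast
qed

text \<open>
  The blocks through \<open>z\<close>, with \<open>z\<close> removed, partition the points outside the group of \<open>z\<close>.
\<close>
lemma card_blocks_through:
  assumes z: "z \<in> points"
  shows "card {B \<in> Blocks. z \<in> B} * (w - 1) = (M - 1) * T"
proof -
  let ?Bz = "{B \<in> Blocks. z \<in> B}"
  have "{z' \<in> points. fst z' \<noteq> fst z} = (\<Union>B\<in>?Bz. B - {z})" (is "?L = ?R")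
  proof (intro equalityI subsetI)
    fix z' assume z': "z' \<in> ?L"
    then obtain B where "B \<in> Blocks" "z \<in> B" "z' \<in> B" using unique_block[OF z, of z'] by auto
    then show "z' \<in> ?R" using z' by auto
  next
    fix z' assume "z' \<in> ?R"
    then obtain B where B: "B \<in> Blocks" "z \<in> B" "z' \<in> B" "z' \<noteq> z" by auto
    then have "fst z' \<noteq> fst z" using inj_on_fst[OF B(1)] by (auto dest: inj_onD)
    then show "z' \<in> ?L" using B block_subset by blast
  qed
  moreover have "?L = ({..<M} - {fst z}) \<times> {..<T}" by auto
  moreover have "card (({..<M} - {fst z}) \<times> {..<T}) = (M - 1) * T"
    using z by (simp add: card_cartesian_product mem_Times_iff)
  moreover have "card (\<Union>B\<in>?Bz. B - {z}) = (\<Sum>B\<in>?Bz. card (B - {z}))"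
  proof (rule card_UN_disjoint)
    show "\<forall>A\<in>?Bz. \<forall>B\<in>?Bz. A \<noteq> B \<longrightarrow> (A - {z}) \<inter> (B - {z}) = {}"
      using block_eqI[of _ _ z] by blast
  qed (use finite_Blocks finite_block in auto)
  moreover have "\<dots> = (\<Sum>B\<in>?Bz. w - 1)"
    using card_block finite_block by (intro sum.cong) auto
  ultimately show ?thesis by simp
qed

text \<open>
  The number of blocks through a point; it is the inner floor of the Johnson bound.
\<close>
definition replication :: nat where
  "replication = (M - 1) * T div (w - 1)"

lemma replication_mult: "replication * (w - 1) = (M - 1) * T"
proof -
  have "(0, 0) \<in> points" using M_ge2 T_pos by auto
  from card_blocks_through[OF this] have "(w - 1) dvd (M - 1) * T" by (metis dvd_triv_right)
  then show ?thesis by (simp add: replication_def)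
qed

lemma card_Blocks: "card Blocks * w = M * T * replication"
proof -
  have deg: "card {B \<in> Blocks. z \<in> B} = replication" if "z \<in> points" for z
    using card_blocks_through[OF that] replication_mult w_ge2 by (metis mult_cancel2 diff_is_0_eq not_less_eq_eq numeral_2_eq_2 One_nat_def)
  (* Incident point-block pairs are counted in two ways. *)
  have "card Blocks * w = (\<Sum>B\<in>Blocks. card {z \<in> points. z \<in> B})"
  proof -
    have "{z \<in> points. z \<in> B} = B" if "B \<in> Blocks" for B using block_subset[OF that] by auto
    then show ?thesis using card_block by simp
  qed
  also have "\<dots> = (\<Sum>z\<in>points. card {B \<in> Blocks. z \<in> B})"
    using finite_Blocks by (intro sum_multicount_gen) auto
  also have "\<dots> = M * T * replication" using deg by simp
  finally show ?thesis .
qed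

lemma shift_shift: "shift_point T s (shift_point T t z) = shift_point T (s + t) z"
  by (simp add: shift_point_def mod_simps add_ac)

lemma shift_period: "z \<in> points \<Longrightarrow> shift_point T (T * k) z = z"
  by (auto simp: shift_point_def)

lemma shift_block_period:
  assumes "B \<in> Blocks"
  shows "shift_point T (T * k) ` B = B"
proof -
  have "shift_point T (T * k) ` B = (\<lambda>z. z) ` B"
    using shift_period block_subset[OF assms] by (intro image_cong) auto
  then show ?thesis by simp
qed

lemma shift_mod: "shift_point T (t mod T) z = shift_point T t z"
  by (simp add: shift_point_def mod_simps)

definition orbit :: "(nat \<times> nat) set \<Rightarrow> (nat \<times> nat) set set" where
  "orbit B = {shift_point T t ` B | t. True}"

text \<open>
  A nontrivial shift moves a point of a block within its group, hence out of the block. So the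
  orbits have full length.
\<close>
lemma card_orbit:
  assumes B: "B \<in> Blocks"
  shows "card (orbit B) = T"
proof -
  have "orbit B = (\<lambda>t. shift_point T t ` B) ` {..<T}"
  proof (intro equalityI subsetI)
    fix A assume "A \<in> orbit B"
    then obtain t where "A = shift_point T t ` B" by (auto simp: orbit_def)
    then have "A = shift_point T (t mod T) ` B" by (simp add: shift_mod)
    then show "A \<in> (\<lambda>t. shift_point T t ` B) ` {..<T}" using T_pos by auto
  qed (auto simp: orbit_def)
  moreover have "inj_on (\<lambda>t. shift_point T t ` B) {..<T}"
  proof (rule inj_onI)
    fix s t assume st: "s \<in> {..<T}" "t \<in> {..<T}" and eq: "shift_point T s ` B = shift_point T t ` B"
    have "B \<noteq> {}" using card_block[OF B] w_ge2 by auto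
    then obtain z where z: "z \<in> B" by blast
    then obtain z' where z': "z' \<in> B" "shift_point T s z = shift_point T t z'" using eq by blast
    then have "z' = z" using inj_on_fst[OF B] z by (auto simp: shift_point_def dest: inj_onD)
    then have "(snd z + s) mod T = (snd z + t) mod T" using z' by (simp add: shift_point_def)
    then have "[s = t] (mod T)" by (simp add: cong_add_lcancel_nat flip: cong_def)
    then show "s = t" using st by (simp add: cong_def)
  qed
  ultimately show ?thesis by (simp add: card_image)
qed

lemma orbit_eqI:
  assumes A: "A \<in> Blocks" and B: "B \<in> Blocks" and C: "C \<in> orbit A" "C \<in> orbit B"
  shows "orbit A = orbit B"
proof -
  have "orbit A \<subseteq> orbit B" if A: "A \<in> Blocks" and C: "C \<in> orbit A" "C \<in> orbit B" for A B C
  proof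
    obtain s where s: "C = shift_point T s ` A" using C(1) by (auto simp: orbit_def)
    obtain t where t: "C = shift_point T t ` B" using C(2) by (auto simp: orbit_def)
    fix D assume "D \<in> orbit A"
    then obtain u where "D = shift_point T u ` A" by (auto simp: orbit_def)
    (* The shift by T * s - s inverts the shift by s, because T * s is at least s. *)
    also have "A = shift_point T (T * s) ` A" using shift_block_period[OF A] by simp
    also have "\<dots> = shift_point T (T * s - s + s) ` A" using T_pos by simp
    also have "\<dots> = shift_point T (T * s - s) ` C"
      unfolding s by (simp only: image_image shift_shift)
    finally have "D = shift_point T (u + (T * s - s + t)) ` B"
      unfolding t by (simp only: image_image shift_shift)
    then show "D \<in> orbit B" by (auto simp: orbit_def)
  qed
  from this[OF A C] this[OF B C(2,1)] show ?thesis by blast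
qed

lemma orbit_subset: "B \<in> Blocks \<Longrightarrow> orbit B \<subseteq> Blocks"
  using shift_closed by (auto simp: orbit_def)

lemma self_in_orbit: "B \<in> Blocks \<Longrightarrow> B \<in> orbit B"
  using shift_block_period[of B 0] by (force simp: orbit_def)

text \<open>
  One block from each orbit. The last property is what bounds the cross-correlation: a shifted
  block never coincides with another representative.
\<close>
lemma orbit_representatives:
  obtains C where "C \<subseteq> Blocks" and "card C * w = M * replication"
    and "\<And>A B t. A \<in> C \<Longrightarrow> B \<in> C \<Longrightarrow> A = shift_point T t ` B \<Longrightarrow> A = B"
proof -
  define rep where "rep U = (SOME B. B \<in> U)" for U :: "(nat \<times> nat) set set"
  have rep: "rep (orbit B) \<in> orbit B" if "B \<in> Blocks" for B
    unfolding rep_def using self_in_orbit[OF that] by (rule someI)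
  define C where "C = rep ` (orbit ` Blocks)"
  have inj: "inj_on rep (orbit ` Blocks)"
    by (rule inj_onI) (metis imageE orbit_eqI rep)
  have Union: "\<Union> (orbit ` Blocks) = Blocks" using orbit_subset self_in_orbit by blast
  have "T * card (orbit ` Blocks) = card (\<Union> (orbit ` Blocks))"
  proof (rule card_partition)
    fix U V assume "U \<in> orbit ` Blocks" "V \<in> orbit ` Blocks" and ne: "U \<noteq> V"
    then obtain A B where "A \<in> Blocks" "U = orbit A" "B \<in> Blocks" "V = orbit B" by blast
    then show "U \<inter> V = {}" using orbit_eqI[of A B] ne by blast
  qed (use finite_Blocks card_orbit in \<open>auto simp only: Union finite_imageI image_iff\<close>)
  then have orbits: "card Blocks = T * card (orbit ` Blocks)" unfolding Union ..
  have "T * (card C * w) = card Blocks * w"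
    by (simp add: orbits C_def card_image[OF inj])
  then have "T * (card C * w) = T * (M * replication)"
    unfolding card_Blocks by (simp add: mult_ac)
  then have "card C * w = M * replication" using T_pos by simp
  moreover have CB: "C \<subseteq> Blocks" using rep orbit_subset by (auto simp: C_def)
  moreover have "A = B" if A: "A \<in> C" and B: "B \<in> C" and eq: "A = shift_point T t ` B" for A B t
  proof -
    have AB: "A \<in> Blocks" "B \<in> Blocks" using A B CB by auto
    obtain A' where A': "A' \<in> Blocks" "A = rep (orbit A')" using A by (auto simp: C_def)
    obtain B' where B': "B' \<in> Blocks" "B = rep (orbit B')" using B by (auto simp: C_def)
    have "A \<in> orbit A'" using A' rep by simp
    then have "orbit A = orbit A'" using orbit_eqI[OF AB(1) A'(1)] self_in_orbit AB by blast
    moreover have "B \<in> orbit B'" using B' rep by simp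
    then have "orbit B = orbit B'" using orbit_eqI[OF AB(2) B'(1)] self_in_orbit AB by blast
    moreover have "A \<in> orbit B" using eq by (auto simp: orbit_def)
    then have "orbit A = orbit B" using orbit_eqI[OF AB] self_in_orbit AB by blast
    ultimately show "A = B" using A' B' by simp
  qed
  ultimately show thesis using that by blast
qed

end

lemma finite_card_tuples:
  shows "finite {y. list_all2 (<) y (Ls :: nat list)}"
    and "card {y. list_all2 (<) y (Ls :: nat list)} = prod_list Ls"
proof (induction Ls)
  case (Cons L Ls)
  let ?S = "{y. list_all2 (<) y Ls}"
  have eq: "{y. list_all2 (<) y (L # Ls)} = (\<lambda>(a, y). a # y) ` ({..<L} \<times> ?S)"
    by (auto simp: list_all2_Cons2)
  { case 1
    show ?case unfolding eq using Cons.IH by simp }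
  { case 2
    have "inj_on (\<lambda>(a, y). a # y) ({..<L} \<times> ?S)" by (auto intro: inj_onI)
    then show ?case unfolding eq using Cons.IH by (simp add: card_image card_cartesian_product) }
qed simp_all

lemma indices_snoc: "indices Ls T = {y @ [i] | y i. list_all2 (<) y Ls \<and> i < T}"
proof
  show "indices Ls T \<subseteq> {y @ [i] | y i. list_all2 (<) y Ls \<and> i < T}"
    by (auto simp: indices_def list_all2_append2 list_all2_Cons2)
  show "{y @ [i] | y i. list_all2 (<) y Ls \<and> i < T} \<subseteq> indices Ls T"
    by (auto simp: indices_def intro: list_all2_appendI)
qed

text \<open>
  Only the last subscript carries the cyclic structure, so any enumeration of the other subscripts
  turns arrays into functions on the points and respects the shift.
\<close>
lemma indices_bij_points:
  obtains \<phi> where "bij_betw \<phi> (indices Ls T) ({..<prod_list Ls} \<times> {..<T})"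
    and "\<And>x t. x \<in> indices Ls T \<Longrightarrow> \<phi> (shift_last T t x) = shift_point T t (\<phi> x)"
proof -
  obtain b where b: "bij_betw b {y. list_all2 (<) y Ls} {..<prod_list Ls}"
    using ex_bij_betw_finite_nat[OF finite_card_tuples(1)[of Ls]] finite_card_tuples(2)[of Ls]
    by (auto simp: atLeast0LessThan)
  define \<phi> where "\<phi> x = (b (butlast x), last x)" for x
  have "bij_betw \<phi> (indices Ls T) ({..<prod_list Ls} \<times> {..<T})"
  proof (rule bij_betwI')
    fix x y assume "x \<in> indices Ls T" "y \<in> indices Ls T"
    then show "\<phi> x = \<phi> y \<longleftrightarrow> x = y"
      using bij_betw_imp_inj_on[OF b] by (auto simp: \<phi>_def indices_snoc dest: inj_onD)
  next
    fix x assume "x \<in> indices Ls T"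
    then show "\<phi> x \<in> {..<prod_list Ls} \<times> {..<T}"
      using bij_betw_apply[OF b] by (auto simp: \<phi>_def indices_snoc)
  next
    fix z assume z: "z \<in> {..<prod_list Ls} \<times> {..<T}"
    then obtain y where y: "list_all2 (<) y Ls" "fst z = b y"
      using bij_betw_imp_surj_on[OF b] by (auto simp: mem_Times_iff image_iff set_eq_iff)
    then have "y @ [snd z] \<in> indices Ls T" using z by (auto simp: indices_snoc)
    moreover have "z = \<phi> (y @ [snd z])" using y by (simp add: \<phi>_def prod_eq_iff)
    ultimately show "\<exists>x\<in>indices Ls T. z = \<phi> x" by blast
  qed
  moreover have "\<phi> (shift_last T t x) = shift_point T t (\<phi> x)" for x t
    by (simp add: \<phi>_def shift_last_def shift_point_def)
  ultimately show thesis using that by blast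
qed

lemma shift_last_indices:
  assumes "x \<in> indices Ls T"
  shows "shift_last T t x \<in> indices Ls T"
  using assms by (auto simp: indices_snoc shift_last_def intro: mod_less_divisor)

text \<open>
  The characteristic functions of orbit representatives form the code. A correlation is the number
  of points of one block that a shift carries into another. A point and its shift lie in the same
  group, so they cannot both lie in a block; two points of \<open>A\<close> carried into \<open>B\<close> would lie on both
  \<open>A\<close> and a shift of \<open>B\<close>, which are different blocks.
\<close>
lemma (in cyclic_block_design) J_optimal_code:
  assumes M: "M = prod_list Ls"
  shows "\<exists>C. J_optimal_ideal_OOC Ls T w 1 C"
proof -
  obtain \<phi> where bij: "bij_betw \<phi> (indices Ls T) points"
    and shift: "\<And>x t. x \<in> indices Ls T \<Longrightarrow> \<phi> (shift_last T t x) = shift_point T t (\<phi> x)"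
    using indices_bij_points[of Ls T] unfolding M by blast
  obtain R where R: "R \<subseteq> Blocks" and card_R: "card R * w = M * replication"
    and rep: "\<And>A B t. A \<in> R \<Longrightarrow> B \<in> R \<Longrightarrow> A = shift_point T t ` B \<Longrightarrow> A = B"
    using orbit_representatives by blast
  have R_points: "A \<subseteq> points" if "A \<in> R" for A using block_subset R that by blast
  define code where "code B = (\<lambda>x\<in>indices Ls T. if \<phi> x \<in> B then 1 else 0 :: nat)" for B
  have fin: "finite (indices Ls T)" using bij bij_betw_finite by blast
  have card_pull: "card {x \<in> indices Ls T. \<phi> x \<in> A} = card A" if "A \<subseteq> points" for A
  proof -
    have "\<phi> ` {x \<in> indices Ls T. \<phi> x \<in> A} = A"
    proof (intro equalityI subsetI)
      fix z assume z: "z \<in> A"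
      then have "z \<in> \<phi> ` indices Ls T" using that bij_betw_imp_surj_on[OF bij] by blast
      then show "z \<in> \<phi> ` {x \<in> indices Ls T. \<phi> x \<in> A}" using z by blast
    qed auto
    moreover have "inj_on \<phi> {x \<in> indices Ls T. \<phi> x \<in> A}"
      using bij_betw_imp_inj_on[OF bij] by (rule inj_on_subset) auto
    ultimately show ?thesis by (metis card_image)
  qed
  have corr: "correlation Ls T t (code A) (code B) = card {z \<in> A. shift_point T t z \<in> B}"
    if "A \<subseteq> points" for A B t
  proof -
    have "correlation Ls T t (code A) (code B)
        = (\<Sum>x\<in>indices Ls T. if \<phi> x \<in> {z \<in> A. shift_point T t z \<in> B} then 1 else 0)"
      unfolding correlation_def
      by (intro sum.cong) (auto simp: code_def shift shift_last_indices)
    also have "\<dots> = card {x \<in> indices Ls T. \<phi> x \<in> {z \<in> A. shift_point T t z \<in> B}}"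
      using fin by (simp add: sum.If_cases Int_def)
    also have "\<dots> = card {z \<in> A. shift_point T t z \<in> B}"
      by (rule card_pull) (use that in auto)
    finally show ?thesis .
  qed
  have auto_corr: "correlation Ls T t (code A) (code A) = 0" if A: "A \<in> R" and t: "t \<in> {1..<T}" for A t
  proof -
    have "shift_point T t z \<notin> A" if z: "z \<in> A" for z
    proof
      assume "shift_point T t z \<in> A"
      then have "shift_point T t z = z"
        using z A R by (intro inj_onD[OF inj_on_fst[of A]]) (auto simp: shift_point_def)
      then have "(snd z + t) mod T = snd z" by (simp add: shift_point_def prod_eq_iff)
      moreover have "snd z < T" using subsetD[OF R_points[OF A] z] by (simp add: mem_Times_iff)
      ultimately show False using t by (cases "snd z + t < T") (auto simp: mod_if split: if_splits)
    qed
    then have "{z \<in> A. shift_point T t z \<in> A} = {}" by blast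
    then show ?thesis unfolding corr[OF R_points[OF A]] by (simp only: card.empty)
  qed
  have cross_corr: "correlation Ls T t (code A) (code B) \<le> 1"
    if A: "A \<in> R" and B: "B \<in> R" and ne: "code A \<noteq> code B" and t: "t \<in> {0..<T}" for A B t
  proof -
    let ?X = "{z \<in> A. shift_point T t z \<in> B}"
    have AB: "A \<in> Blocks" "B \<in> Blocks" using A B R by auto
    have pull: "z \<in> shift_point T (T - t) ` B" if z: "z \<in> ?X" for z
    proof -
      have "z \<in> points" using z block_subset[OF AB(1)] by auto
      then have "shift_point T (T - t) (shift_point T t z) = z"
        using t shift_period[of z 1] by (simp add: shift_shift)
      then show ?thesis using z by (metis (mono_tags, lifting) image_eqI mem_Collect_eq)
    qed
    have "z = z'" if "z \<in> ?X" "z' \<in> ?X" for z z'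
    proof (rule ccontr)
      assume "z \<noteq> z'"
      then have "A = shift_point T (T - t) ` B"
        using that pull by (intro block_eqI[OF AB(1) shift_closed[OF AB(2)]]) auto
      then have "A = B" by (rule rep[OF A B])
      then show False using ne by simp
    qed
    moreover have "finite ?X" using finite_block[OF AB(1)] by simp
    ultimately have "card ?X \<le> 1" unfolding One_nat_def by (subst card_le_Suc0_iff_eq) blast+
    then show ?thesis using corr block_subset[OF AB(1)] by simp
  qed
  have weight: "card {x \<in> indices Ls T. code A x = 1} = w" if "A \<in> R" for A
  proof -
    have "{x \<in> indices Ls T. code A x = 1} = {x \<in> indices Ls T. \<phi> x \<in> A}"
      by (auto simp: code_def)
    then show ?thesis using card_pull[OF R_points[OF that]] card_block that R by auto
  qed
  have inj_code: "inj_on code R"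
  proof (rule inj_onI)
    fix A B assume AB: "A \<in> R" "B \<in> R" and eq: "code A = code B"
    have "z \<in> A \<longleftrightarrow> z \<in> B" if z: "z \<in> points" for z
    proof -
      obtain x where "x \<in> indices Ls T" "z = \<phi> x" using z bij_betw_imp_surj_on[OF bij] by blast
      then show ?thesis using fun_cong[OF eq, of x] by (auto simp: code_def split: if_splits)
    qed
    moreover have "A \<subseteq> points" "B \<subseteq> points" using AB R_points by auto
    ultimately show "A = B" by blast
  qed
  have r_pos: "replication > 0"
  proof -
    have "replication * (w - 1) > 0" unfolding replication_mult using M_ge2 T_pos by simp
    then show ?thesis by simp
  qed
  have "OOC Ls T w 0 1 (code ` R)"
    unfolding OOC_def
  proof (intro conjI)
    have "card R \<noteq> 0" using card_R r_pos M_ge2 by (intro notI) simp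
    then show "code ` R \<noteq> {}" by auto
    show "code ` R \<subseteq> binary_arrays Ls T" by (auto simp: binary_arrays_def code_def split: if_splits)
  qed (use weight auto_corr cross_corr in auto)
  (* Both quotients inside the floors are integers. *)
  moreover have "int (card (code ` R)) = johnson_bound_ideal Ls T w 1"
  proof -
    have "(real (M * T) - real T) / (real w - 1) = real replication"
    proof -
      have "real replication * (real w - 1) = real (replication * (w - 1))" using w_ge2 by (simp add: of_nat_diff)
      also have "\<dots> = real (M * T) - real T"
        unfolding replication_mult using M_ge2 by (simp add: of_nat_diff algebra_simps)
      finally show ?thesis using w_ge2 by (simp add: field_simps)
    qed
    moreover have "real (M * T) / (real T * real w) * real replication = real (card R)"
    proof -
      have "real (card R) * real w = real M * real replication" using card_R by (metis of_nat_mult)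
      then show ?thesis using T_pos w_ge2 by (simp add: field_simps)
    qed
    ultimately show ?thesis
      unfolding johnson_bound_ideal_1 M[symmetric] Let_def card_image[OF inj_code] by simp
  qed
  ultimately show ?thesis unfolding J_optimal_ideal_OOC_def by blast
qed

section \<open>Finite fields\<close>

lemma (in cring) binomial_expansion:
  assumes x: "x \<in> carrier R" and y: "y \<in> carrier R"
  shows "(x \<oplus> y) [^] n = (\<Oplus>k\<in>{..n}. [(n choose k)] \<cdot> (x [^] k \<otimes> y [^] (n - k)))"
proof (induction n)
  case 0
  show ?case using x y by (simp add: finsum_0)
next
  case (Suc n)
  define t where "t k = x [^] k \<otimes> y [^] (Suc n - k)" for k
  have t[simp]: "t k \<in> carrier R" for k using x y by (simp add: t_def)
  (* Multiplication by x raises the exponent of x, multiplication by y that of y;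
     the two sums are then merged by Pascal's rule. *)
  have X: "x \<otimes> ([c] \<cdot> (x [^] k \<otimes> y [^] (n - k))) = [c] \<cdot> t (Suc k)" for c :: nat and k
    using x y by (simp add: t_def add_pow_rdistr m_lcomm m_comm)
  have Y: "y \<otimes> ([c] \<cdot> (x [^] k \<otimes> y [^] (n - k))) = [c] \<cdot> t k" if "k \<le> n" for c :: nat and k
    using x y that by (simp add: t_def add_pow_rdistr Suc_diff_le m_lcomm m_comm)
  have "(x \<oplus> y) [^] Suc n
      = x \<otimes> (\<Oplus>k\<in>{..n}. [(n choose k)] \<cdot> (x [^] k \<otimes> y [^] (n - k)))
        \<oplus> y \<otimes> (\<Oplus>k\<in>{..n}. [(n choose k)] \<cdot> (x [^] k \<otimes> y [^] (n - k)))"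
    using x y Suc.IH by (simp only: nat_pow_Suc2 l_distr add.m_closed nat_pow_closed finsum_closed) (simp add: l_distr)
  also have "\<dots> = (\<Oplus>k\<in>{..n}. [(n choose k)] \<cdot> t (Suc k)) \<oplus> (\<Oplus>k\<in>{..n}. [(n choose k)] \<cdot> t k)"
    by (intro arg_cong2[of _ _ _ _ "(\<oplus>)"] trans[OF finsum_rdistr] finsum_cong')
      (use x y X Y in simp_all)
  also have "(\<Oplus>k\<in>{..n}. [(n choose k)] \<cdot> t k) = (\<Oplus>k\<in>{..Suc n}. [(n choose k)] \<cdot> t k)"
    by (simp add: finsum_Suc binomial_eq_0)
  also have "\<dots> = (\<Oplus>k\<in>{..n}. [(n choose Suc k)] \<cdot> t (Suc k)) \<oplus> t 0"
    by (simp add: finsum_Suc2 del: finsum_Suc)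
  also have "(\<Oplus>k\<in>{..n}. [(n choose k)] \<cdot> t (Suc k)) \<oplus> \<dots>
      = (\<Oplus>k\<in>{..n}. [(Suc n choose Suc k)] \<cdot> t (Suc k)) \<oplus> t 0"
    by (simp add: add.nat_pow_mult[symmetric] finsum_addf a_assoc del: add.nat_pow_mult)
  also have "\<dots> = (\<Oplus>k\<in>{..Suc n}. [(Suc n choose k)] \<cdot> t k)"
    by (subst finsum_Suc2) simp_all
  finally show ?case by (simp only: t_def)
qed

text \<open>
  In characteristic \<open>p\<close> all inner binomial coefficients of exponent \<open>p\<close> vanish; iterate \<open>e\<close> times.
  The statement is for commutative rings, because it is used for a polynomial ring as well.
\<close>
lemma (in cring) frobenius_add:
  fixes p :: nat
  assumes p: "prime p" and char: "[p] \<cdot> \<one> = \<zero>"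
    and x: "x \<in> carrier R" and y: "y \<in> carrier R"
  shows "(x \<oplus> y) [^] (p ^ e) = x [^] (p ^ e) \<oplus> y [^] (p ^ e)"
proof (induction e)
  case 0
  show ?case using x y by (simp add: nat_pow_eone)
next
  case (Suc e)
  have p_times: "[(p * c)] \<cdot> z = \<zero>" if "z \<in> carrier R" for c and z
  proof -
    have "[(p * c)] \<cdot> z = [c] \<cdot> ([p] \<cdot> (\<one> \<otimes> z))"
      using that by (simp add: add.nat_pow_pow)
    also have "\<dots> = [c] \<cdot> (([p] \<cdot> \<one>) \<otimes> z)"
      using that by (simp only: add_pow_ldistr one_closed)
    finally show ?thesis using that by (simp add: char)
  qed
  have frobenius: "(a \<oplus> b) [^] p = a [^] p \<oplus> b [^] p" if a: "a \<in> carrier R" and b: "b \<in> carrier R" for a b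
  proof -
    obtain r where r: "p = Suc (Suc r)"
      using prime_ge_2_nat[OF p] by (metis add_2_eq_Suc le_Suc_ex)
    have vanish: "[(p choose Suc k)] \<cdot> (a [^] Suc k \<otimes> b [^] (p - Suc k)) = \<zero>" if "k \<le> r" for k
    proof -
      have "p dvd (p choose Suc k)"
        using that r p by (intro dvd_choose_prime) auto
      then obtain c where c: "(p choose Suc k) = p * c" by (elim dvdE)
      show ?thesis unfolding c by (rule p_times) (use a b in simp)
    qed
    have "(a \<oplus> b) [^] p = (\<Oplus>k\<in>{..Suc (Suc r)}. [(p choose k)] \<cdot> (a [^] k \<otimes> b [^] (p - k)))"
      using binomial_expansion[OF a b, of p] unfolding r .
    also have "\<dots> = a [^] p \<oplus> ((\<Oplus>k\<in>{..r}. [(p choose Suc k)] \<cdot> (a [^] Suc k \<otimes> b [^] (p - Suc k))) \<oplus> b [^] p)"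
      using a b by (subst finsum_Suc, simp, subst finsum_Suc2, simp) (simp add: r del: binomial_Suc_Suc finsum_Suc)
    also have "(\<Oplus>k\<in>{..r}. [(p choose Suc k)] \<cdot> (a [^] Suc k \<otimes> b [^] (p - Suc k))) = (\<Oplus>k\<in>{..r}. \<zero>)"
      by (rule finsum_cong') (use vanish in auto)
    finally show ?thesis using a b by simp
  qed
  have "(x \<oplus> y) [^] (p ^ Suc e) = ((x \<oplus> y) [^] (p ^ e)) [^] p"
    using x y by (simp add: nat_pow_pow mult.commute)
  then show ?case
    using x y Suc.IH frobenius by (simp add: nat_pow_pow mult.commute)
qed

lemma (in field) frobenius_fixed_subfield:
  fixes p :: nat
  assumes p: "prime p" and char: "[p] \<cdot> \<one> = \<zero>"
  shows "subfield {x \<in> carrier R. x [^] (p ^ e) = x} R" (is "subfield ?K R")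
proof (rule subfieldI')
  have n: "p ^ e \<noteq> 0" using p by (simp add: prime_gt_0_nat)
  show "subring ?K R"
  proof (rule subringI)
    fix h assume h: "h \<in> ?K"
    have "(\<ominus> h) [^] (p ^ e) \<oplus> h [^] (p ^ e) = (\<ominus> h \<oplus> h) [^] (p ^ e)"
      using h by (intro frobenius_add[OF p char, symmetric]) auto
    also have "\<dots> = \<zero>" using h n by (simp add: l_neg nat_pow_zero del: power_eq_0_iff)
    finally have "(\<ominus> h) [^] (p ^ e) \<oplus> h = \<zero>" using h by simp
    then show "\<ominus> h \<in> ?K"
      using h minus_equality[of "(\<ominus> h) [^] (p ^ e)" h] by simp
  qed (use frobenius_add[OF p char] in \<open>auto simp: nat_pow_distrib\<close>)
  fix k assume k: "k \<in> ?K - {\<zero>}"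
  then have u: "k \<in> Units R" by (simp add: field_Units)
  have "k \<otimes> (inv k) [^] (p ^ e) = k [^] (p ^ e) \<otimes> (inv k) [^] (p ^ e)" using k by simp
  also have "\<dots> = (k \<otimes> inv k) [^] (p ^ e)" using k u by (intro nat_pow_distrib[symmetric]) auto
  also have "\<dots> = \<one>" using u by simp
  finally have "inv k = (inv k) [^] (p ^ e)" using k u by (intro comm_inv_char) auto
  then show "inv k \<in> ?K" using k u by simp
qed

lemma (in ring_hom_ring) hom_add_pow:
  fixes k :: nat
  assumes "x \<in> carrier R"
  shows "h ([k] \<cdot>\<^bsub>R\<^esub> x) = [k] \<cdot>\<^bsub>S\<^esub> h x"
  using assms by (induction k) simp_all

text \<open>
  The polynomial \<open>f = X\<^sup>n - X\<close> with \<open>n = p\<^sup>e\<close> splits, so it remains to see that its roots are simple.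
  If \<open>a\<close> is a root and \<open>Y = X - a\<close>, then additivity of the Frobenius map in the polynomial ring gives
  \<open>f = Y\<^sup>n - Y\<close>. A double root would make \<open>Y\<^sup>2\<close> a divisor of \<open>f\<close>, hence of \<open>Y\<close>.
\<close>
lemma (in algebraically_closed) card_frobenius_fixed:
  fixes p :: nat
  assumes p: "prime p" and char: "[p] \<cdot> \<one> = \<zero>" and e: "e > 0"
  shows "card {x \<in> carrier L. x [^] (p ^ e) = x} = p ^ e"
proof -
  let ?P = "poly_ring L"
  define n where "n = p ^ e"
  have n: "n > 1" unfolding n_def using p e by (intro one_less_power prime_gt_1_nat)
  interpret UP: domain ?P using univ_poly_is_domain[OF carrier_is_subring] .
  have charP: "[p] \<cdot>\<^bsub>?P\<^esub> \<one>\<^bsub>?P\<^esub> = \<zero>\<^bsub>?P\<^esub>"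
  proof -
    interpret C: ring_hom_ring L ?P poly_of_const
      by (rule ring_hom_ringI2[OF ring_axioms UP.ring_axioms])
         (use canonical_embedding_is_hom[OF carrier_is_subring] in simp)
    show ?thesis using C.hom_add_pow[of \<one> p] char by simp
  qed
  define f where "f = X [^]\<^bsub>?P\<^esub> n \<ominus>\<^bsub>?P\<^esub> X"
  have X: "X \<in> carrier ?P" by (rule var_closed(1)[OF carrier_is_subring])
  have f: "f \<in> carrier ?P" using X by (simp add: f_def)
  have deg: "degree f = n"
  proof -
    have nX: "\<ominus>\<^bsub>?P\<^esub> X = [\<ominus> \<one>, \<ominus> \<zero>]"
      using univ_poly_a_inv_def'[OF carrier_is_subring X] by (simp add: var_def)
    have "degree (X [^]\<^bsub>?P\<^esub> n) = n"
      using polynomial_pow_degree[OF X, of n] by (simp add: var_def)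
    moreover have "degree (\<ominus>\<^bsub>?P\<^esub> X) = 1" by (simp add: nX)
    moreover have "polynomial (carrier L) (X [^]\<^bsub>?P\<^esub> n)" "polynomial (carrier L) (\<ominus>\<^bsub>?P\<^esub> X)"
      using X by (simp_all add: univ_poly_carrier)
    ultimately have "degree (poly_add (X [^]\<^bsub>?P\<^esub> n) (\<ominus>\<^bsub>?P\<^esub> X)) = max n 1"
      using poly_add_degree_eq[OF carrier_is_subring, of "X [^]\<^bsub>?P\<^esub> n" "\<ominus>\<^bsub>?P\<^esub> X"] n by simp
    then show ?thesis using n by (simp only: f_def a_minus_def univ_poly_add max.absorb3)
  qed
  have eval_f: "eval f x = x [^] n \<ominus> x" if x: "x \<in> carrier L" for x
  proof -
    interpret ev: ring_hom_cring ?P L "\<lambda>p. eval p x"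
      by (rule eval_cring_hom[OF carrier_is_subring x])
    show ?thesis using X x by (simp add: f_def a_minus_def eval_var)
  qed
  have f0: "f \<noteq> []" using deg n by auto
  have roots: "set_mset (roots f) = {x \<in> carrier L. x [^] n = x}"
  proof (rule Set.set_eqI)
    fix x
    have "x \<in># roots f \<longleftrightarrow> x \<in> carrier L \<and> eval f x = \<zero>"
      unfolding roots_mem_iff_is_root[OF f] is_root_def using f0 by blast
    then show "x \<in># roots f \<longleftrightarrow> x \<in> {x \<in> carrier L. x [^] n = x}"
      using eval_f r_right_minus_eq nat_pow_closed by (metis (mono_tags, lifting) mem_Collect_eq)
  qed
  have simple: "count (roots f) a = 1" if a: "a \<in># roots f" for a
  proof (rule ccontr)
    assume "count (roots f) a \<noteq> 1"
    moreover have "count (roots f) a \<noteq> 0" using a by simp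
    ultimately have two: "2 \<le> alg_mult f a"
      unfolding alg_mult_eq_count_roots[OF f] by linarith
    have "a \<in> {x \<in> carrier L. x [^] n = x}" using a unfolding roots .
    then have aL: "a \<in> carrier L" and afix: "a [^] n = a" by simp_all
    define c where "c = poly_of_const (\<ominus> a)"
    define Y where "Y = X \<oplus>\<^bsub>?P\<^esub> c"
    interpret C: ring_hom_ring L ?P poly_of_const
      by (rule ring_hom_ringI2[OF ring_axioms UP.ring_axioms])
         (use canonical_embedding_is_hom[OF carrier_is_subring] in simp)
    have c: "c \<in> carrier ?P" using aL by (simp add: c_def)
    have "(\<ominus> a) [^] n = \<ominus> a"
      using subringE(5)[OF subfieldE(1)[OF frobenius_fixed_subfield[OF p char, of e, folded n_def]], of a]
        aL afix by simp
    then have c_fix: "c [^]\<^bsub>?P\<^esub> n = c"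
      unfolding c_def using C.hom_nat_pow[OF a_inv_closed[OF aL], of n] by metis
    have Y: "Y \<in> carrier ?P" using X c by (simp add: Y_def)
    have Y_eq: "Y = [\<one>, \<ominus> a]"
      using aL by (simp add: Y_def c_def poly_of_const_def var_def univ_poly_add)
    have f_Y: "f = Y [^]\<^bsub>?P\<^esub> n \<ominus>\<^bsub>?P\<^esub> Y"
      unfolding f_def Y_def UP.frobenius_add[OF p charP X c, of e, folded n_def] c_fix
      using X c UP.nat_pow_closed[OF X, of n] by algebra
    have "(Y [^]\<^bsub>?P\<^esub> (2::nat)) pdivides f"
      using le_alg_mult_imp_pdivides[OF aL f two] unfolding Y_eq .
    then obtain h where h: "h \<in> carrier ?P" "f = Y [^]\<^bsub>?P\<^esub> (2::nat) \<otimes>\<^bsub>?P\<^esub> h"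
      unfolding pdivides_def factor_def by auto
    have "Y [^]\<^bsub>?P\<^esub> n = Y [^]\<^bsub>?P\<^esub> (2::nat) \<otimes>\<^bsub>?P\<^esub> Y [^]\<^bsub>?P\<^esub> (n - 2)"
      using UP.nat_pow_mult[OF Y, of 2 "n - 2"] le_add_diff_inverse[of 2 n] n by (metis Suc_1 Suc_leI)
    then have "f = Y [^]\<^bsub>?P\<^esub> (2::nat) \<otimes>\<^bsub>?P\<^esub> Y [^]\<^bsub>?P\<^esub> (n - 2) \<ominus>\<^bsub>?P\<^esub> Y"
      using f_Y by simp
    (* b and b' stand for the powers of Y, which the ring normalization would otherwise expand. *)
    moreover have "Y = b \<otimes>\<^bsub>?P\<^esub> (b' \<ominus>\<^bsub>?P\<^esub> h)"
      if "b \<otimes>\<^bsub>?P\<^esub> h = b \<otimes>\<^bsub>?P\<^esub> b' \<ominus>\<^bsub>?P\<^esub> Y" "b \<in> carrier ?P" "b' \<in> carrier ?P" for b b'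
    proof -
      have "Y = b \<otimes>\<^bsub>?P\<^esub> b' \<ominus>\<^bsub>?P\<^esub> (b \<otimes>\<^bsub>?P\<^esub> b' \<ominus>\<^bsub>?P\<^esub> Y)" using that(2,3) Y by algebra
      also have "\<dots> = b \<otimes>\<^bsub>?P\<^esub> (b' \<ominus>\<^bsub>?P\<^esub> h)" unfolding that(1)[symmetric] using that(2,3) h(1) by algebra
      finally show ?thesis .
    qed
    ultimately have "Y = Y [^]\<^bsub>?P\<^esub> (2::nat) \<otimes>\<^bsub>?P\<^esub> (Y [^]\<^bsub>?P\<^esub> (n - 2) \<ominus>\<^bsub>?P\<^esub> h)"
      using h(2) Y by (metis UP.nat_pow_closed)
    then have "(Y [^]\<^bsub>?P\<^esub> (2::nat)) pdivides Y"
      unfolding pdivides_def factor_def using Y h by blast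
    then have "degree (Y [^]\<^bsub>?P\<^esub> (2::nat)) \<le> degree Y"
      using Y Y_eq by (intro pdivides_imp_degree_le[OF carrier_is_subring]) auto
    then show False using polynomial_pow_degree[OF Y, of 2] Y_eq by simp
  qed
  have "card (set_mset (roots f)) = size (roots f)"
    unfolding size_multiset_overloaded_eq using simple by simp
  also have "\<dots> = n" using roots_over_carrier[OF f] deg by (simp add: splitted_def)
  finally show ?thesis unfolding roots by (simp only: n_def)
qed

text \<open>
  The field is the fixed field of the \<open>e\<close>-fold Frobenius map in the algebraic closure of the prime
  field, which determines the type of its elements.
\<close>
lemma finite_field_exists:
  fixes p e :: nat
  assumes p: "prime p" and e: "e > 0"
  obtains R :: "((int list \<times> nat) multiset \<Rightarrow> int) ring"
  where "field R" and "card (carrier R) = p ^ e" and "[p] \<cdot>\<^bsub>R\<^esub> \<one>\<^bsub>R\<^esub> = \<zero>\<^bsub>R\<^esub>"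
proof -
  interpret Zp: residues_prime p "residue_ring (int p)"
    using p by (simp add: residues_prime_def)
  define L where "L = field.alg_closure (residue_ring (int p))"
  interpret L: algebraic_closure L "ring.indexed_const (residue_ring (int p)) ` carrier (residue_ring (int p))"
    unfolding L_def by (rule Zp.alg_closureE)
  interpret h: ring_hom_ring "residue_ring (int p)" L "ring.indexed_const (residue_ring (int p))"
    using ring_hom_ringI2[OF Zp.ring_axioms L.ring_axioms] Zp.alg_closureE(2) by (simp add: L_def)
  let ?k = "\<lambda>k::nat. [k] \<cdot>\<^bsub>residue_ring (int p)\<^esub> \<one>\<^bsub>residue_ring (int p)\<^esub>"
  have "?k k = int k mod int p" for k
    by (induction k) (simp_all add: Zp.res_zero_eq Zp.res_one_eq Zp.res_add_eq mod_add_right_eq add.commute)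
  from this[of p] have charL: "[p] \<cdot>\<^bsub>L\<^esub> \<one>\<^bsub>L\<^esub> = \<zero>\<^bsub>L\<^esub>"
    using h.hom_add_pow[of "\<one>\<^bsub>residue_ring (int p)\<^esub>" p] by (simp flip: Zp.res_zero_eq)
  let ?E = "{x \<in> carrier L. x [^]\<^bsub>L\<^esub> (p ^ e) = x}"
  have sub: "subfield ?E L" by (rule L.frobenius_fixed_subfield[OF p charL])
  have "[k] \<cdot>\<^bsub>L\<lparr>carrier := ?E\<rparr>\<^esub> x = [k] \<cdot>\<^bsub>L\<^esub> x" for k :: nat and x
    by (simp add: add_pow_def nat_pow_def)
  then show thesis
    using that[OF L.subfield_iff(2)[OF sub]] L.card_frobenius_fixed[OF p charL e] charL by simp
qed

text \<open>
  A generator has order \<open>|R| - 1 = P (q - 1)\<close>, so \<open>g\<^sup>n\<^sup>(\<^sup>q\<^sup>-\<^sup>1\<^sup>) = 1\<close> exactly when \<open>P\<close> divides \<open>n\<close>.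
\<close>
lemma (in field) generator_power_frobenius_fixed_iff:
  assumes fin: "finite (carrier R)" and g: "g \<in> carrier (Multiplicative_Group.mult_of R)"
    and gen: "carrier (Multiplicative_Group.mult_of R) = {g [^] i | i::nat. i \<in> UNIV}"
    and P: "P * (q - 1) = card (carrier R) - 1" and q: "q > 1"
  shows "(g [^] n) [^] q = g [^] n \<longleftrightarrow> P dvd (n :: nat)"
proof -
  interpret G: group "Multiplicative_Group.mult_of R"
    rewrites "([^]\<^bsub>Multiplicative_Group.mult_of R\<^esub>) = (([^]) :: _ \<Rightarrow> nat \<Rightarrow> _)" and "\<one>\<^bsub>Multiplicative_Group.mult_of R\<^esub> = \<one>"
    by (rule field_mult_group) (simp_all add: Multiplicative_Group.mult_of_simps)
  have finG: "finite (carrier (Multiplicative_Group.mult_of R))" using fin by simp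
  have "carrier (Multiplicative_Group.mult_of R) = (\<lambda>i. g [^] i) ` {0..G.ord g - 1}"
    using gen G.ord_elems[OF finG g] by auto
  then have "order (Multiplicative_Group.mult_of R) \<le> card {0..G.ord g - 1}"
    unfolding order_def by (metis card_image_le finite_atLeastAtMost)
  then have "order (Multiplicative_Group.mult_of R) = G.ord g"
    using G.ord_ge_1[OF finG g] G.ord_le_group_order[OF finG g] by simp
  then have ord: "G.ord g = P * (q - 1)"
    using order_mult_of[OF fin] P by (simp add: order_def)
  have gn: "g [^] n \<in> carrier R - {\<zero>}" using G.nat_pow_closed[OF g, of n] by simp
  have "(g [^] n) [^] q = g [^] n \<longleftrightarrow> (g [^] n) [^] (q - 1) \<otimes> g [^] n = \<one> \<otimes> g [^] n"
    using gn q by (cases q) auto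
  also have "\<dots> \<longleftrightarrow> (g [^] n) [^] (q - 1) = \<one>"
    using gn by (intro m_rcancel) auto
  also have "\<dots> \<longleftrightarrow> g [^] (n * (q - 1)) = \<one>"
    using g by (simp add: nat_pow_pow)
  also have "\<dots> \<longleftrightarrow> P * (q - 1) dvd n * (q - 1)"
    using G.pow_eq_id[OF g, of "n * (q - 1)"] by (simp add: ord)
  also have "\<dots> \<longleftrightarrow> P dvd n" using q by simp
  finally show ?thesis .
qed

section \<open>Lines of a projective space in cyclic coordinates\<close>

text \<open>
  The projective geometry of \<open>R\<close> over \<open>F\<close> and its spread of one-dimensional \<open>K\<close>-subspaces. The
  sizes of \<open>F\<close> and \<open>K\<close> are encoded by the powers of the generator that they contain.
\<close>
locale cyclic_field_tower = field R for R (structure) +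
  fixes F K :: "'a set" and g :: 'a and M T :: nat
  assumes subfield_F: "subfield F R" and subfield_K: "subfield K R" and finite_F: "finite F"
    and g_carrier: "g \<in> carrier R - {\<zero>}"
    and g_generates: "\<And>x. x \<in> carrier R - {\<zero>} \<Longrightarrow> \<exists>n::nat. x = g [^] n"
    and power_in_K: "\<And>n::nat. g [^] n \<in> K \<longleftrightarrow> M dvd n"
    and power_in_F: "\<And>n::nat. g [^] n \<in> F \<longleftrightarrow> M * T dvd n"
    and M_pos: "M > 0" and T_pos: "T > 0"
begin

definition points :: "(nat \<times> nat) set" where
  "points = {..<M} \<times> {..<T}"

text \<open>The chosen vector that represents the projective point with coordinates \<open>x\<close>.\<close>
definition pt :: "nat \<times> nat \<Rightarrow> 'a" where
  "pt x = g [^] (fst x + M * snd x)"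

text \<open>
  The \<open>F\<close>-span of two vectors; it is a projective line, as a set of vectors, when these are
  independent over \<open>F\<close>.
\<close>
definition line :: "'a \<Rightarrow> 'a \<Rightarrow> 'a set" where
  "line x y = {a \<otimes> x \<oplus> b \<otimes> y | a b. a \<in> F \<and> b \<in> F}"

text \<open>
  Linear independence of two vectors over the subfield \<open>S\<close>. Over \<open>F\<close> it says that they span a line,
  over \<open>K\<close> that this line is not contained in a spread element.
\<close>
definition indep :: "'a set \<Rightarrow> 'a \<Rightarrow> 'a \<Rightarrow> bool" where
  "indep S x y \<longleftrightarrow> x \<in> carrier R \<and> y \<in> carrier R - {\<zero>} \<and> (\<forall>k\<in>S. x \<noteq> k \<otimes> y)"

definition block :: "'a \<Rightarrow> 'a \<Rightarrow> (nat \<times> nat) set" where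
  "block x y = {z \<in> points. pt z \<in> line x y}"

lemmas F_closed = subringE(2,3,5,6,7)[OF subfieldE(1)[OF subfield_F]]
lemmas K_closed = subringE(2,3,5,6,7)[OF subfieldE(1)[OF subfield_K]]

lemma F_carrier [simp]: "a \<in> F \<Longrightarrow> a \<in> carrier R"
  using subfieldE(3)[OF subfield_F] by blast

lemma K_carrier [simp]: "a \<in> K \<Longrightarrow> a \<in> carrier R"
  using subfieldE(3)[OF subfield_K] by blast

lemma power_nonzero [simp]: "g [^] (n::nat) \<noteq> \<zero>" "g [^] (n::nat) \<in> carrier R"
  using g_carrier by (induction n) (auto simp: integral_iff)

lemma pt_carrier [simp]: "pt x \<in> carrier R" "pt x \<noteq> \<zero>"
  by (simp_all add: pt_def)

lemma F_subset_K: "F \<subseteq> K"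
proof
  fix x assume x: "x \<in> F"
  show "x \<in> K"
  proof (cases "x = \<zero>")
    case False
    then obtain n :: nat where n: "x = g [^] n" using g_generates x by fastforce
    then have "M * T dvd n" using x power_in_F by simp
    then show ?thesis using n power_in_K dvd_mult_left by blast
  qed (simp add: K_closed)
qed

text \<open>
  Proportionality over a subfield becomes a congruence of exponents. For \<open>K\<close> it yields the spread,
  for \<open>F\<close> the projective points.
\<close>
lemma ratio_in_subfield_iff:
  assumes S: "subfield S R" and period: "\<And>n::nat. g [^] n \<in> S \<longleftrightarrow> P dvd n"
  shows "(\<exists>k\<in>S. g [^] i = k \<otimes> g [^] j) \<longleftrightarrow> i mod P = j mod (P::nat)"
proof -
  have S_carrier: "k \<in> carrier R" if "k \<in> S" for k
    using subfieldE(3)[OF S] that by blast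
  have split: "g [^] b = g [^] (b - a) \<otimes> g [^] a" if "a \<le> b" for a b :: nat
    using that g_carrier by (simp add: nat_pow_mult)
  have up: "(\<exists>k\<in>S. g [^] b = k \<otimes> g [^] a) \<longleftrightarrow> b mod P = a mod P" if "a \<le> b" for a b :: nat
  proof -
    have "(\<exists>k\<in>S. g [^] b = k \<otimes> g [^] a) \<longleftrightarrow> g [^] (b - a) \<in> S"
    proof
      assume "\<exists>k\<in>S. g [^] b = k \<otimes> g [^] a"
      then obtain k where k: "k \<in> S" "g [^] b = k \<otimes> g [^] a" by blast
      then have "g [^] (b - a) \<otimes> g [^] a = k \<otimes> g [^] a"
        using split[OF \<open>a \<le> b\<close>] by metis
      then have "g [^] (b - a) = k"
        using m_rcancel[of "g [^] a" "g [^] (b - a)" k] S_carrier[OF k(1)] by simp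
      then show "g [^] (b - a) \<in> S" using k by simp
    next
      assume "g [^] (b - a) \<in> S"
      then show "\<exists>k\<in>S. g [^] b = k \<otimes> g [^] a" using split[OF \<open>a \<le> b\<close>] by blast
    qed
    also have "\<dots> \<longleftrightarrow> b mod P = a mod P"
      unfolding period using mod_eq_dvd_iff_nat[OF that] by blast
    finally show ?thesis .
  qed
  have sym: "\<exists>k\<in>S. g [^] b = k \<otimes> g [^] a" if "\<exists>k\<in>S. g [^] a = k \<otimes> g [^] b" for a b :: nat
  proof -
    obtain k where k: "k \<in> S" "g [^] a = k \<otimes> g [^] b" using \<open>\<exists>k\<in>S. _\<close> by blast
    then have k0: "k \<in> S - {\<zero>}" using power_nonzero[of a] by auto
    note inv = subfield_m_inv[OF S k0]
    have "inv k \<otimes> g [^] a = g [^] b"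
      unfolding k(2) using inv k(1) S_carrier by (simp flip: m_assoc)
    then show ?thesis using inv(1) by (intro bexI[of _ "inv k"]) auto
  qed
  show ?thesis
  proof (cases "j \<le> i")
    case True
    then show ?thesis by (rule up)
  next
    case False
    have "(\<exists>k\<in>S. g [^] i = k \<otimes> g [^] j) \<longleftrightarrow> (\<exists>k\<in>S. g [^] j = k \<otimes> g [^] i)"
      by (rule iffI; erule sym)
    also have "\<dots> \<longleftrightarrow> i mod P = j mod P"
      unfolding up[OF less_imp_le[OF False[unfolded not_le]]] by (rule eq_commute)
    finally show ?thesis .
  qed
qed

lemma pt_same_orbit_iff:
  assumes "x \<in> points" "y \<in> points"
  shows "(\<exists>k\<in>K. pt x = k \<otimes> pt y) \<longleftrightarrow> fst x = fst y"
  using ratio_in_subfield_iff[OF subfield_K power_in_K, of "fst x + M * snd x" "fst y + M * snd y"] assms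
  by (auto simp: pt_def points_def)

lemma pt_proportional_iff:
  assumes "x \<in> points" "y \<in> points"
  shows "(\<exists>k\<in>F. pt x = k \<otimes> pt y) \<longleftrightarrow> x = y"
proof -
  have less: "fst z + M * snd z < M * T" if "z \<in> points" for z
  proof -
    have "fst z + M * snd z < M * Suc (snd z)" using that by (simp add: points_def mem_Times_iff)
    also have "\<dots> \<le> M * T" using that by (intro mult_le_mono2) (auto simp: points_def)
    finally show ?thesis .
  qed
  have "fst x + M * snd x = fst y + M * snd y \<longleftrightarrow> x = y"
  proof
    assume eq: "fst x + M * snd x = fst y + M * snd y"
    from arg_cong[OF eq, of "\<lambda>n. n mod M"] arg_cong[OF eq, of "\<lambda>n. n div M"]
    show "x = y" using assms M_pos by (auto simp: points_def)
  qed simp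
  then show ?thesis
    using ratio_in_subfield_iff[OF subfield_F power_in_F, of "fst x + M * snd x" "fst y + M * snd y"]
      less[OF assms(1)] less[OF assms(2)]
    by (simp add: pt_def)
qed

lemma pt_surj:
  assumes "z \<in> carrier R - {\<zero>}"
  shows "\<exists>f\<in>F. \<exists>x\<in>points. z = f \<otimes> pt x"
proof -
  obtain n :: nat where n: "z = g [^] n" using g_generates assms by blast
  define x where "x = (n mod M, n div M mod T)"
  have "x \<in> points" using M_pos T_pos by (simp add: x_def points_def)
  moreover have "fst x + M * snd x = n mod (M * T)"
    by (simp add: x_def mod_mult2_eq add.commute)
  then have "\<exists>f\<in>F. g [^] n = f \<otimes> pt x"
    unfolding pt_def using ratio_in_subfield_iff[OF subfield_F power_in_F] by simp
  ultimately show ?thesis using n by blast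
qed

lemma lineI: "a \<in> F \<Longrightarrow> b \<in> F \<Longrightarrow> a \<otimes> x \<oplus> b \<otimes> y \<in> line x y"
  by (auto simp: line_def)

lemma line_carrier: "x \<in> carrier R \<Longrightarrow> y \<in> carrier R \<Longrightarrow> line x y \<subseteq> carrier R"
  by (auto simp: line_def)

lemma line_scale:
  assumes "x \<in> carrier R" "y \<in> carrier R" "u \<in> line x y" "f \<in> F"
  shows "f \<otimes> u \<in> line x y"
proof -
  obtain a b where ab: "a \<in> F" "b \<in> F" "u = a \<otimes> x \<oplus> b \<otimes> y"
    using assms by (auto simp: line_def)
  then have "f \<otimes> u = (f \<otimes> a) \<otimes> x \<oplus> (f \<otimes> b) \<otimes> y"
    using assms by (simp add: r_distr m_assoc)
  then show ?thesis using ab assms F_closed by (simp add: lineI)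
qed

lemma line_endpoints:
  assumes "x \<in> carrier R" "y \<in> carrier R"
  shows "x \<in> line x y" "y \<in> line x y"
  using lineI[of \<one> \<zero> x y] lineI[of \<zero> \<one> x y] assms F_closed(1,2) by simp_all

lemma line_subset:
  assumes xy: "x \<in> carrier R" "y \<in> carrier R" and uv: "u \<in> line x y" "v \<in> line x y"
  shows "line u v \<subseteq> line x y"
proof
  fix z assume "z \<in> line u v"
  then obtain e f where z: "z = e \<otimes> u \<oplus> f \<otimes> v" and ef: "e \<in> F" "f \<in> F" by (auto simp: line_def)
  obtain a b where u: "u = a \<otimes> x \<oplus> b \<otimes> y" and ab: "a \<in> F" "b \<in> F" using uv by (auto simp: line_def)
  obtain c d where v: "v = c \<otimes> x \<oplus> d \<otimes> y" and cd: "c \<in> F" "d \<in> F" using uv by (auto simp: line_def)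
  have "z = (e \<otimes> a \<oplus> f \<otimes> c) \<otimes> x \<oplus> (e \<otimes> b \<oplus> f \<otimes> d) \<otimes> y"
    unfolding z u v using F_carrier[OF ab(1)] F_carrier[OF ab(2)] F_carrier[OF cd(1)] F_carrier[OF cd(2)]
      F_carrier[OF ef(1)] F_carrier[OF ef(2)] xy by algebra
  then show "z \<in> line x y" using ab cd ef F_closed by (simp add: lineI)
qed

lemma indep_K_imp_F: "indep K x y \<Longrightarrow> indep F x y"
  using F_subset_K by (auto simp: indep_def)

text \<open>
  Two coordinate pairs of the same vector give a linear relation between \<open>x\<close> and \<open>y\<close>.
\<close>
lemma inj_coordinates:
  assumes "indep F x y"
  shows "inj_on (\<lambda>(a, b). a \<otimes> x \<oplus> b \<otimes> y) (F \<times> F)"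
proof (rule inj_onI, clarify)
  fix a b a' b'
  assume F: "a \<in> F" "b \<in> F" "a' \<in> F" "b' \<in> F" and eq: "a \<otimes> x \<oplus> b \<otimes> y = a' \<otimes> x \<oplus> b' \<otimes> y"
  have x: "x \<in> carrier R" and y: "y \<in> carrier R" "y \<noteq> \<zero>" and ne: "\<And>k. k \<in> F \<Longrightarrow> x \<noteq> k \<otimes> y"
    using assms by (auto simp: indep_def)
  have c: "a \<in> carrier R" "b \<in> carrier R" "a' \<in> carrier R" "b' \<in> carrier R" using F by auto
  have "(a \<ominus> a') \<otimes> x = (a \<otimes> x \<oplus> b \<otimes> y) \<ominus> a' \<otimes> x \<ominus> b \<otimes> y"
    using c x y(1) by algebra
  also have "\<dots> = (b' \<ominus> b) \<otimes> y" unfolding eq using c x y(1) by algebra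
  finally have dep: "(a \<ominus> a') \<otimes> x = (b' \<ominus> b) \<otimes> y" .
  have "a \<ominus> a' = \<zero>"
  proof (rule ccontr)
    assume "a \<ominus> a' \<noteq> \<zero>"
    moreover have "a \<ominus> a' \<in> F" "b' \<ominus> b \<in> F" using F F_closed by (auto simp: a_minus_def)
    ultimately have k0: "a \<ominus> a' \<in> F - {\<zero>}" and bF: "b' \<ominus> b \<in> F" by auto
    note inv = subfield_m_inv[OF subfield_F k0]
    have "x = inv (a \<ominus> a') \<otimes> ((a \<ominus> a') \<otimes> x)"
      using inv c x by (simp flip: m_assoc)
    also have "\<dots> = (inv (a \<ominus> a') \<otimes> (b' \<ominus> b)) \<otimes> y"
      unfolding dep using inv c y by (simp add: m_assoc)
    finally show False using ne inv(1) bF F_closed by auto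
  qed
  moreover from this have "(b' \<ominus> b) \<otimes> y = \<zero>" using dep x by (metis l_null)
  then have "b' \<ominus> b = \<zero>" using y c integral[of "b' \<ominus> b" y] by auto
  ultimately show "a = a' \<and> b = b'" using c by (metis r_right_minus_eq)
qed

lemma line_image: "line x y = (\<lambda>(a, b). a \<otimes> x \<oplus> b \<otimes> y) ` (F \<times> F)"
  by (auto simp: line_def)

lemma card_line: "indep F x y \<Longrightarrow> card (line x y) = card F * card F"
  unfolding line_image by (simp add: card_image[OF inj_coordinates] card_cartesian_product)

lemma finite_line: "finite (line x y)"
  unfolding line_image using finite_F by simp

text \<open>
  Two independent vectors of a line span it: the span is a subset with the same number of elements.
\<close>
lemma line_eqI:
  assumes "indep F x y" "indep F u v" "u \<in> line x y" "v \<in> line x y"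
  shows "line u v = line x y"
proof (rule card_subset_eq[OF finite_line])
  show "line u v \<subseteq> line x y" using assms by (intro line_subset) (auto simp: indep_def)
  show "card (line u v) = card (line x y)" using assms by (simp add: card_line)
qed

lemma card_F_ge2: "card F \<ge> 2"
  using card_mono[OF finite_F, of "{\<zero>, \<one>}"] F_closed(1,2) by simp

text \<open>
  In a set of vectors that is closed under scalars from \<open>F\<close>, every projective point accounts for
  \<open>|F| - 1\<close> nonzero vectors. It is used for lines, which counts the points of a block, and for the
  whole space, which determines \<open>|F|\<close>.
\<close>
lemma card_cone:
  assumes S: "S \<subseteq> carrier R" and scale: "\<And>f u. f \<in> F \<Longrightarrow> u \<in> S \<Longrightarrow> f \<otimes> u \<in> S"
  shows "card (S - {\<zero>}) = (card F - 1) * card {z \<in> points. pt z \<in> S}"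
proof -
  let ?Z = "{z \<in> points. pt z \<in> S}"
  have "bij_betw (\<lambda>(f, z). f \<otimes> pt z) ((F - {\<zero>}) \<times> ?Z) (S - {\<zero>})"
  proof (intro bij_betw_imageI inj_onI equalityI subsetI)
    fix s t assume st: "s \<in> (F - {\<zero>}) \<times> ?Z" "t \<in> (F - {\<zero>}) \<times> ?Z"
      and st_eq: "(case s of (f, z) \<Rightarrow> f \<otimes> pt z) = (case t of (f, z) \<Rightarrow> f \<otimes> pt z)"
    obtain f z where s: "s = (f, z)" by (cases s)
    obtain f' z' where t: "t = (f', z')" by (cases t)
    have eq: "f \<otimes> pt z = f' \<otimes> pt z'" using st_eq s t by simp
    have f: "f \<in> F - {\<zero>}" "f' \<in> F - {\<zero>}" and z: "z \<in> points" "z' \<in> points"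
      using st s t by auto
    note inv = subfield_m_inv[OF subfield_F f(1)]
    have "pt z = inv f \<otimes> (f \<otimes> pt z)" using inv f by (simp flip: m_assoc)
    also have "\<dots> = (inv f \<otimes> f') \<otimes> pt z'" unfolding eq using inv f by (simp add: m_assoc)
    finally have zz: "z = z'" using pt_proportional_iff[OF z] inv(1) f F_closed(4) by blast
    then have "f = f'" using eq f m_rcancel[of "pt z'" f f'] by simp
    then show "s = t" using zz s t by simp
  next
    fix u assume "u \<in> (\<lambda>(f, z). f \<otimes> pt z) ` ((F - {\<zero>}) \<times> ?Z)"
    then show "u \<in> S - {\<zero>}"
      using scale by (auto simp: integral_iff)
  next
    fix u assume u: "u \<in> S - {\<zero>}"
    then have "u \<in> carrier R - {\<zero>}" using S by blast
    then obtain f z where fz: "f \<in> F" "z \<in> points" "u = f \<otimes> pt z" using pt_surj by blast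
    then have f0: "f \<in> F - {\<zero>}" using u by auto
    note inv = subfield_m_inv[OF subfield_F f0]
    have "pt z = inv f \<otimes> u" unfolding fz using inv fz by (simp flip: m_assoc)
    then have "z \<in> ?Z" using scale[of "inv f" u] u inv(1) fz by simp
    then show "u \<in> (\<lambda>(f, z). f \<otimes> pt z) ` ((F - {\<zero>}) \<times> ?Z)"
      using fz f0 by force
  qed
  then have "card ((F - {\<zero>}) \<times> ?Z) = card (S - {\<zero>})" by (rule bij_betw_same_card)
  then show ?thesis using finite_F F_closed(1) by (simp add: card_cartesian_product)
qed

lemma card_carrier: "card (carrier R - {\<zero>}) = (card F - 1) * (M * T)"
proof -
  have "{z \<in> points. pt z \<in> carrier R} = points" by simp
  then show ?thesis using card_cone[of "carrier R"] by (simp add: points_def card_cartesian_product)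
qed

lemma card_block:
  assumes "indep F x y"
  shows "card (block x y) = card F + 1"
proof -
  have xy: "x \<in> carrier R" "y \<in> carrier R" using assms by (auto simp: indep_def)
  have "\<zero> \<in> line x y" using line_scale[OF xy line_endpoints(1)[OF xy] F_closed(1)] xy by simp
  then have "(card F - 1) * card (block x y) = card F * card F - 1"
    using card_cone[OF line_carrier[OF xy] line_scale[OF xy]] finite_line card_line[OF assms]
    by (simp add: block_def)
  also have "\<dots> = (card F - 1) * (card F + 1)"
    using card_F_ge2 by (simp add: algebra_simps)
  finally show ?thesis using card_F_ge2 by (simp only: mult_cancel1) simp
qed

lemma indep_pt:
  assumes "z \<in> points" "z' \<in> points" "fst z \<noteq> fst z'"
  shows "indep K (pt z) (pt z')"
  using assms pt_same_orbit_iff[OF assms(1,2)] by (auto simp: indep_def)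

text \<open>
  If two points of a line lie in one spread element, then the whole line does, since it is spanned
  by them; so \<open>x\<close> and \<open>y\<close> would be proportional over \<open>K\<close>.
\<close>
lemma inj_on_fst_block:
  assumes "indep K x y"
  shows "inj_on fst (block x y)"
proof (rule inj_onI, rule ccontr)
  fix z z' assume z: "z \<in> block x y" "z' \<in> block x y" and eq: "fst z = fst z'" and ne: "z \<noteq> z'"
  have zP: "z \<in> points" "z' \<in> points" using z by (auto simp: block_def)
  have xy: "x \<in> carrier R" "y \<in> carrier R" "y \<noteq> \<zero>" and xk: "\<And>k. k \<in> K \<Longrightarrow> x \<noteq> k \<otimes> y"
    using assms by (auto simp: indep_def)
  obtain k where k: "k \<in> K" "pt z = k \<otimes> pt z'"
    using pt_same_orbit_iff[OF zP] eq by blast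
  have "indep F (pt z) (pt z')" using pt_proportional_iff[OF zP] ne by (auto simp: indep_def)
  then have line: "line (pt z) (pt z') = line x y"
    using z by (intro line_eqI[OF indep_K_imp_F[OF assms]]) (auto simp: block_def)
  have multiple: "\<exists>c\<in>K. u = c \<otimes> pt z'" if u: "u \<in> line x y" for u
  proof -
    obtain a b where ab: "a \<in> F" "b \<in> F" "u = a \<otimes> pt z \<oplus> b \<otimes> pt z'"
      using u unfolding line[symmetric] by (auto simp: line_def)
    then have "u = (a \<otimes> k \<oplus> b) \<otimes> pt z'" using k by (simp add: l_distr m_assoc)
    moreover have "a \<otimes> k \<oplus> b \<in> K" using ab(1,2) k(1) F_subset_K by (intro K_closed(4,5)) auto
    ultimately show ?thesis by blast
  qed
  obtain c where c: "c \<in> K" "x = c \<otimes> pt z'" using multiple line_endpoints xy by blast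
  obtain d where d: "d \<in> K" "y = d \<otimes> pt z'" using multiple line_endpoints xy by blast
  have d0: "d \<in> K - {\<zero>}" using d xy by auto
  note inv = subfield_m_inv[OF subfield_K d0]
  have "pt z' = inv d \<otimes> y" unfolding d(2) using inv d(1) by (simp flip: m_assoc)
  then have "x = (c \<otimes> inv d) \<otimes> y" using c inv xy by (simp add: m_assoc)
  then show False using xk c(1) inv(1) K_closed(4) by blast
qed

definition blocks :: "(nat \<times> nat) set set" where
  "blocks = {block x y | x y. indep K x y}"

lemma unique_block:
  assumes "z \<in> points" "z' \<in> points" "fst z \<noteq> fst z'"
  shows "\<exists>!B. B \<in> blocks \<and> z \<in> B \<and> z' \<in> B"
proof (rule ex1I)
  show "block (pt z) (pt z') \<in> blocks \<and> z \<in> block (pt z) (pt z') \<and> z' \<in> block (pt z) (pt z')"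
    using indep_pt[OF assms] assms line_endpoints by (auto simp: blocks_def block_def)
next
  fix B assume "B \<in> blocks \<and> z \<in> B \<and> z' \<in> B"
  then obtain x y where B: "B = block x y" and xy: "indep K x y" and "pt z \<in> line x y" "pt z' \<in> line x y"
    by (auto simp: blocks_def block_def)
  then have "line (pt z) (pt z') = line x y" by (intro line_eqI indep_K_imp_F indep_pt assms)
  then show "B = block (pt z) (pt z')" by (simp add: B block_def)
qed

text \<open>
  Multiplication by \<open>h = g\<^sup>M\<^sup>t\<close> maps lines to lines and shifts the second coordinate by \<open>t\<close>. The
  reduction modulo \<open>T\<close> changes the exponent by a multiple of \<open>M T\<close>, that is, the vector by a factor
  from \<open>F\<close>. One inclusion is enough, since all blocks have the same size.
\<close>
lemma block_shift:
  assumes B: "B \<in> blocks"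
  shows "shift_point T t ` B \<in> blocks"
proof -
  obtain x y where B: "B = block x y" and xy: "indep K x y"
    using B by (auto simp: blocks_def)
  have c: "x \<in> carrier R" "y \<in> carrier R" "y \<noteq> \<zero>" and ne: "\<And>k. k \<in> K \<Longrightarrow> x \<noteq> k \<otimes> y"
    using xy by (auto simp: indep_def)
  define h where "h = g [^] (M * t)"
  have h: "h \<in> carrier R" "h \<noteq> \<zero>" by (simp_all add: h_def)
  have indep: "indep K (x \<otimes> h) (y \<otimes> h)"
    unfolding indep_def
  proof (intro conjI ballI)
    fix k assume k: "k \<in> K"
    then show "x \<otimes> h \<noteq> k \<otimes> (y \<otimes> h)"
      using ne[OF k] c h m_rcancel[of h x "k \<otimes> y"] by (simp add: m_assoc)
  qed (use c h in \<open>auto simp: integral_iff\<close>)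
  let ?s = "shift_point T t"
  have "?s ` B \<subseteq> block (x \<otimes> h) (y \<otimes> h)"
  proof (intro subsetI, elim imageE)
    fix z w assume w: "w \<in> B" and z: "z = ?s w"
    have "fst z + M * snd z = fst w + M * (snd w + t) mod (M * T)"
      by (simp only: z shift_point_def fst_conv snd_conv mult_mod_right)
    then have "(fst z + M * snd z) mod (M * T) = (fst w + M * snd w + M * t) mod (M * T)"
      by (simp only: mod_add_right_eq add.assoc distrib_left)
    then obtain f where f: "f \<in> F" "pt z = f \<otimes> (pt w \<otimes> h)"
      using ratio_in_subfield_iff[OF subfield_F power_in_F, of "fst z + M * snd z" "fst w + M * snd w + M * t"] g_carrier
      by (auto simp: pt_def h_def nat_pow_mult)
    obtain a b where ab: "a \<in> F" "b \<in> F" "pt w = a \<otimes> x \<oplus> b \<otimes> y"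
      using w by (auto simp: B block_def line_def)
    have "pt w \<otimes> h = a \<otimes> (x \<otimes> h) \<oplus> b \<otimes> (y \<otimes> h)"
      unfolding ab using ab(1,2) c h by (simp add: l_distr m_assoc)
    then have "pt w \<otimes> h \<in> line (x \<otimes> h) (y \<otimes> h)" using ab by (auto simp: line_def)
    then have "pt z \<in> line (x \<otimes> h) (y \<otimes> h)" unfolding f(2) using line_scale[of "x \<otimes> h" "y \<otimes> h" "pt w \<otimes> h" f] c h f(1) by simp
    moreover have "z \<in> points" using w T_pos by (auto simp: z B block_def points_def shift_point_def)
    ultimately show "z \<in> block (x \<otimes> h) (y \<otimes> h)" by (simp add: block_def)
  qed
  moreover have "inj_on ?s B"
  proof (rule inj_on_imageI2[of fst])
    show "inj_on (fst \<circ> ?s) B"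
      using inj_on_fst_block[OF xy] by (simp add: B inj_on_def shift_point_def)
  qed
  then have "card (?s ` B) = card (block (x \<otimes> h) (y \<otimes> h))"
    by (simp add: card_image B card_block indep_K_imp_F indep xy)
  moreover have "finite (block (x \<otimes> h) (y \<otimes> h))"
    by (rule finite_subset[of _ points]) (auto simp: block_def points_def)
  ultimately have "?s ` B = block (x \<otimes> h) (y \<otimes> h)" by (intro card_subset_eq)
  then show ?thesis using indep by (auto simp: blocks_def)
qed

end

section \<open>The code\<close>

text \<open>
  The design of all lines of \<open>GF(Q\<^sup>m)\<close> over \<open>GF(q)\<close> that lie in no spread element, with
  \<open>Q = q\<^sup>d\<^sup>+\<^sup>1\<close>. The subfields are fixed fields of powers of the Frobenius map.
\<close>
lemma cyclic_block_design_exists: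
  assumes q: "primepow q" and m: "m > 1"
  shows "\<exists>Blocks. cyclic_block_design (theta (m - 1) (q ^ (d + 1))) (theta d q) (q + 1) Blocks"
proof -
  obtain p e where p: "prime p" and e: "e > 0" and q_eq: "q = p ^ e"
    using q by (auto simp: primepow_def)
  have q2: "q > 1" using primepow_gt_Suc_0[OF q] by simp
  define Q where "Q = q ^ (d + 1)"
  define M where "M = theta (m - 1) Q"
  define T where "T = theta d q"
  have Q_eq: "Q = p ^ (e * (d + 1))" by (simp only: Q_def q_eq power_mult)
  have Q2: "Q > 1" unfolding Q_def by (rule one_less_power[OF q2]) simp
  have MQ: "M * (Q - 1) = Q ^ m - 1" using theta_mult[of "m - 1" Q] m by (simp add: M_def)
  have TQ: "T * (q - 1) = Q - 1" using theta_mult[of d q] by (simp add: T_def Q_def)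
  have "Q ^ 1 < Q ^ m" using Q2 m by (intro power_strict_increasing)
  then have "1 * (Q - 1) < M * (Q - 1)" unfolding MQ using Q2 by simp
  then have M2: "M \<ge> 2" by (simp only: mult_less_cancel2) simp
  have "T * (q - 1) > 0" unfolding TQ using Q2 by simp
  then have T0: "T > 0" by simp
  obtain R :: "((int list \<times> nat) multiset \<Rightarrow> int) ring" where "field R"
    and card_R: "card (carrier R) = p ^ (e * (d + 1) * m)"
    and char: "[p] \<cdot>\<^bsub>R\<^esub> \<one>\<^bsub>R\<^esub> = \<zero>\<^bsub>R\<^esub>"
    using finite_field_exists[OF p, of "e * (d + 1) * m"] e m by auto
  interpret R: field R by fact
  have card_R': "card (carrier R) = Q ^ m" by (simp only: card_R Q_eq power_mult)
  have fin: "finite (carrier R)" using card_R' Q2 by (intro card_ge_0_finite) simp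
  obtain g where g: "g \<in> carrier (Multiplicative_Group.mult_of R)"
    and gen: "carrier (Multiplicative_Group.mult_of R) = {g [^]\<^bsub>R\<^esub> i | i::nat. i \<in> UNIV}"
    using R.finite_field_mult_group_has_gen[OF fin] by blast
  define F where "F = {x \<in> carrier R. x [^]\<^bsub>R\<^esub> q = x}"
  define K where "K = {x \<in> carrier R. x [^]\<^bsub>R\<^esub> Q = x}"
  have g_closed: "g [^]\<^bsub>R\<^esub> n \<in> carrier R" for n :: nat using g by simp
  have MTq: "M * T * (q - 1) = Q ^ m - 1" by (simp only: mult.assoc TQ MQ)
  interpret cyclic_field_tower R F K g M T
  proof (intro cyclic_field_tower.intro cyclic_field_tower_axioms.intro)
    show "field R" by fact
    show "subfield F R" unfolding F_def q_eq by (rule R.frobenius_fixed_subfield[OF p char])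
    show "subfield K R" unfolding K_def Q_eq by (rule R.frobenius_fixed_subfield[OF p char])
    show "finite F" using fin by (simp add: F_def)
    show "g \<in> carrier R - {\<zero>\<^bsub>R\<^esub>}" using g by simp
    show "\<exists>n::nat. x = g [^]\<^bsub>R\<^esub> n" if "x \<in> carrier R - {\<zero>\<^bsub>R\<^esub>}" for x
      using that gen by auto
    show "g [^]\<^bsub>R\<^esub> n \<in> K \<longleftrightarrow> M dvd n" for n :: nat
      using R.generator_power_frobenius_fixed_iff[OF fin g gen, of M Q n] g_closed MQ card_R' Q2
      by (simp add: K_def)
    show "g [^]\<^bsub>R\<^esub> n \<in> F \<longleftrightarrow> M * T dvd n" for n :: nat
      using R.generator_power_frobenius_fixed_iff[OF fin g gen, of "M * T" q n] g_closed MTq card_R' q2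
      by (simp add: F_def)
  qed (use M2 T0 in auto)
  (* F is defined by an equation; its order follows by counting all vectors. *)
  have "(card F - 1) * (M * T) = (q - 1) * (M * T)"
    using card_carrier MTq card_R' card_Diff_singleton[OF R.zero_closed] by (metis mult.commute)
  then have "card F - 1 = q - 1" using M2 T0 by simp
  then have card_F: "card F = q" using card_F_ge2 q2 by simp
  have "cyclic_block_design M T (q + 1) blocks"
  proof
    show "B \<subseteq> {..<M} \<times> {..<T}" if "B \<in> blocks" for B
      using that by (auto simp: blocks_def block_def points_def)
    show "card B = q + 1" if "B \<in> blocks" for B
      using that card_block indep_K_imp_F card_F by (auto simp: blocks_def)
    show "inj_on fst B" if "B \<in> blocks" for B
      using that inj_on_fst_block by (auto simp: blocks_def)
    show "\<exists>!B. B \<in> blocks \<and> z \<in> B \<and> z' \<in> B"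
      if "z \<in> {..<M} \<times> {..<T}" "z' \<in> {..<M} \<times> {..<T}" "fst z \<noteq> fst z'" for z z'
      using that by (intro unique_block) (simp_all add: points_def)
    show "shift_point T t ` B \<in> blocks" if "B \<in> blocks" for B t
      using that by (rule block_shift)
  qed (use M2 T0 q2 in auto)
  then show ?thesis unfolding M_def T_def Q_def by blast
qed

theorem corollary3p3:
  fixes q d m n :: nat and Ls :: "nat list"
  assumes "primepow q" and "d \<ge> 1" and "m > 1" and "n \<ge> 2"
    and "length Ls = n - 1"
    and "\<forall>L\<in>set Ls. L > 0"
    and "prod_list Ls = theta (m - 1) (q ^ (d + 1))"
  shows "\<exists>C. J_optimal_ideal_OOC Ls (theta d q) (q + 1) 1 C"
proof -
  obtain Blocks where "cyclic_block_design (theta (m - 1) (q ^ (d + 1))) (theta d q) (q + 1) Blocks"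
    using cyclic_block_design_exists[OF assms(1,3)] by blast
  then show ?thesis
    using assms(7) by (intro cyclic_block_design.J_optimal_code) auto
qed

end
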